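(* Let $H$ be a separable right quaternionic Hilbert space, let $U$ be an invertible bounded right linear operator on $H$, and let $\Lambda=\{(W_j,\Lambda_j,v_j)\}_{j\in J}$ be a $g$-fusion frame for $H$ with respect to a family $\{H_j\}_{j\in J}$ of right quaternionic Hilbert spaces, with bounds $A$ and $B$. Then the family $$\Gamma=\left\{\left(UW_j,\ \Lambda_jP_{W_j}U^*,\ v_j\right)\right\}_{j\in J}$$ is a $UU^*$-$g$-fusion frame for $H$.
   Context: $\mathfrak{Q}$ denotes the real quaternions. A right quaternionic Hilbert space is a right $\mathfrak{Q}$-vector space $H$ with a map $\langle\cdot,\cdot\rangle:H\times H\to\mathfrak{Q}$ satisfying $\langle v,v\rangle>0$ for $v\neq0$, $\overline{\langle u,v\rangle}=\langle v,u\rangle$, $\langle u,v_1+v_2\rangle=\langle u,v_1\rangle+\langle u,v_2\rangle$, $\langle u,vq\rangle=\langle u,v\rangle q$ for $q\in\mathfrak{Q}$, and complete for the norm $\|u\|=\sqrt{\langle u,u\rangle}$. An operator $T$ is right linear if $T(u\alpha+v\beta)=T(u)\alpha+T(v)\beta$ for all vectors $u,v$ and $\alpha,\beta\in\mathfrak{Q}$; it is bounded if $\|Tv\|\le K\|v\|$ for some $K>0$ and all $v$; its adjoint $T^*$ is defined by $\langle v,Tu\rangle=\langle T^*v,u\rangle$. Invertible means bijective with bounded inverse. Subspaces are right $\mathfrak{Q}$-linear subspaces, and $P_W$ is the orthogonal projection of $H$ onto the closed subspace $W$. Let $J\subseteq\mathbb{Z}$, let $\{W_j\}_{j\in J}$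 be closed subspaces of $H$, $\{v_j\}_{j\in J}$ positive real weights, and $\Lambda_j:H\to H_j$ bounded right linear operators. The family $\Lambda=\{(W_j,\Lambda_j,v_j)\}_{j\in J}$ is a $g$-fusion frame for $H$ with respect to $\{H_j\}_{j\in J}$ with bounds $A,B$, where $0<A\le B<\infty$, if $$A\|f\|^2\le\sum_{j\in J}v_j^2\|\Lambda_jP_{W_j}f\|^2\le B\|f\|^2\quad\text{for all }f\in H.$$ For a bounded right linear operator $K$ on $H$, a family $\{(V_j,\Theta_j,v_j)\}_{j\in J}$ (with $V_j\subseteq H$ closed subspaces, $\Theta_j:H\to H_j$ bounded right linear, $v_j>0$) is a $K$-$g$-fusion frame for $H$ if there are constants $0<A'\le B'<\infty$ with $$A'\|K^*f\|^2\le\sum_{j\in J}v_j^2\|\Theta_jP_{V_j}f\|^2\le B'\|f\|^2\quad\text{for all }f\in H.$$ $UW_j$ denotes the image of $W_j$ under $U$. *)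

theory Defs
  imports "HOL-Analysis.Analysis" "HOL-Algebra.AbelCoset"
begin

section \<open>The real quaternions\<close>

datatype quat = Quat (qRe: real) (qI: real) (qJ: real) (qK: real)

lemma quat_eq_iff:
  "p = q \<longleftrightarrow> qRe p = qRe q \<and> qI p = qI q \<and> qJ p = qJ q \<and> qK p = qK q"
  by (cases p; cases q) auto

instantiation quat :: ab_group_add
begin
definition "0 = Quat 0 0 0 0"
definition "p + q = Quat (qRe p + qRe q) (qI p + qI q) (qJ p + qJ q) (qK p + qK q)"
definition "- p = Quat (- qRe p) (- qI p) (- qJ p) (- qK p)"
definition "p - q = Quat (qRe p - qRe q) (qI p - qI q) (qJ p - qJ q) (qK p - qK q)"
instance
  by standard (simp_all add: quat_eq_iff zero_quat_def plus_quat_def uminus_quat_def minus_quat_def)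
end

instantiation quat :: real_div_algebra
begin
definition "1 = Quat 1 0 0 0"
definition "p * q = Quat
  (qRe p * qRe q - qI p * qI q - qJ p * qJ q - qK p * qK q)
  (qRe p * qI q + qI p * qRe q + qJ p * qK q - qK p * qJ q)
  (qRe p * qJ q - qI p * qK q + qJ p * qRe q + qK p * qI q)
  (qRe p * qK q + qI p * qJ q - qJ p * qI q + qK p * qRe q)"
definition "scaleR r q = Quat (r * qRe q) (r * qI q) (r * qJ q) (r * qK q)"
definition "inverse q =
  (let n = (qRe q)\<^sup>2 + (qI q)\<^sup>2 + (qJ q)\<^sup>2 + (qK q)\<^sup>2
   in Quat (qRe q / n) (- qI q / n) (- qJ q / n) (- qK q / n))"
definition "p div q = p * inverse (q :: quat)"
instance
proof
  fix q :: quat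
  assume "q \<noteq> 0"
  define n where "n = (qRe q)\<^sup>2 + (qI q)\<^sup>2 + (qJ q)\<^sup>2 + (qK q)\<^sup>2"
  have "0 \<le> n" by (simp add: n_def)
  moreover have "n \<noteq> 0"
    using \<open>q \<noteq> 0\<close>
    by (simp add: n_def quat_eq_iff zero_quat_def add_nonneg_eq_0_iff)
  ultimately have n: "n \<noteq> 0" by simp
  have inv: "inverse q = Quat (qRe q / n) (- qI q / n) (- qJ q / n) (- qK q / n)"
    by (simp add: inverse_quat_def n_def Let_def)
  show "inverse q * q = 1"
    unfolding inv using n
    by (simp add: quat_eq_iff times_quat_def one_quat_def field_simps)
       (simp add: n_def power2_eq_square)
  show "q * inverse q = 1"
    unfolding inv using n
    by (simp add: quat_eq_iff times_quat_def one_quat_def field_simps)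
       (simp add: n_def power2_eq_square)
qed (simp_all add: quat_eq_iff zero_quat_def one_quat_def plus_quat_def times_quat_def
      scaleR_quat_def inverse_quat_def divide_quat_def Let_def algebra_simps)
end

definition qcnj :: "quat \<Rightarrow> quat" where
  "qcnj q = Quat (qRe q) (- qI q) (- qJ q) (- qK q)"


section \<open>Right quaternionic Hilbert spaces\<close>

text \<open>
  Spaces are records with an explicit carrier, so that a family of spaces indexed by \<open>j\<close> can consist
  of different spaces. The multiplicative fields inherited from \<^typ>\<open>'a ring\<close> play no role.
\<close>

record 'a quat_space = "'a ring" +
  rscale :: "'a \<Rightarrow> quat \<Rightarrow> 'a" (infixl \<open>\<cdot>\<index>\<close> 70)
  qinner :: "'a \<Rightarrow> 'a \<Rightarrow> quat" (\<open>(\<langle>_,/ _\<rangle>\<index>)\<close>)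

text \<open>The value \<open>\<langle>u, u\<rangle>\<close> is a nonnegative real quaternion; its square root is taken via its real part.\<close>

definition qnorm :: "('a, 'm) quat_space_scheme \<Rightarrow> 'a \<Rightarrow> real" where
  "qnorm H u = sqrt (qRe \<langle>u, u\<rangle>\<^bsub>H\<^esub>)"

text \<open>
  The locale \<^locale>\<open>Metric_space\<close> requires a distance that is nonnegative and symmetric on the whole
  type, hence the convention outside the carrier.
\<close>

definition qdist :: "('a, 'm) quat_space_scheme \<Rightarrow> 'a \<Rightarrow> 'a \<Rightarrow> real" where
  "qdist H u v = (if u \<in> carrier H \<and> v \<in> carrier H then qnorm H (u \<ominus>\<^bsub>H\<^esub> v) else 0)"

abbreviation qtopology :: "('a, 'm) quat_space_scheme \<Rightarrow> 'a topology" where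
  "qtopology H \<equiv> Metric_space.mtopology (carrier H) (qdist H)"

locale right_quat_inner_space = abelian_group H for H (structure) +
  assumes rscale_closed [simp, intro]: "u \<in> carrier H \<Longrightarrow> u \<cdot> p \<in> carrier H"
    and rscale_add_left: "\<lbrakk>u \<in> carrier H; v \<in> carrier H\<rbrakk> \<Longrightarrow> (u \<oplus> v) \<cdot> p = u \<cdot> p \<oplus> v \<cdot> p"
    and rscale_add_right: "u \<in> carrier H \<Longrightarrow> u \<cdot> (p + q) = u \<cdot> p \<oplus> u \<cdot> q"
    and rscale_mult: "u \<in> carrier H \<Longrightarrow> u \<cdot> (p * q) = (u \<cdot> p) \<cdot> q"
    and rscale_one [simp]: "u \<in> carrier H \<Longrightarrow> u \<cdot> 1 = u"
    and qinner_pos: "\<lbrakk>u \<in> carrier H; u \<noteq> \<zero>\<rbrakk> \<Longrightarrow> \<exists>r>0. \<langle>u, u\<rangle> = of_real r"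
    and qinner_cnj: "\<lbrakk>u \<in> carrier H; v \<in> carrier H\<rbrakk> \<Longrightarrow> qcnj \<langle>u, v\<rangle> = \<langle>v, u\<rangle>"
    and qinner_add: "\<lbrakk>u \<in> carrier H; v \<in> carrier H; w \<in> carrier H\<rbrakk>
          \<Longrightarrow> \<langle>u, v \<oplus> w\<rangle> = \<langle>u, v\<rangle> + \<langle>u, w\<rangle>"
    and qinner_rscale: "\<lbrakk>u \<in> carrier H; v \<in> carrier H\<rbrakk> \<Longrightarrow> \<langle>u, v \<cdot> q\<rangle> = \<langle>u, v\<rangle> * q"

locale right_quat_hilbert_space = right_quat_inner_space +
  assumes complete: "Metric_space.mcomplete (carrier H) (qdist H)"

definition separable_quat_space :: "('a, 'm) quat_space_scheme \<Rightarrow> bool" where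
  "separable_quat_space H \<longleftrightarrow> separable_space (qtopology H)"


section \<open>The norm metric\<close>

context right_quat_inner_space
begin

lemma qinner_zero_right: "u \<in> carrier H \<Longrightarrow> \<langle>u, \<zero>\<rangle> = 0"
  using qinner_add[of u \<zero> \<zero>] by simp

lemma qinner_minus_right:
  "\<lbrakk>u \<in> carrier H; v \<in> carrier H\<rbrakk> \<Longrightarrow> \<langle>u, \<ominus> v\<rangle> = - \<langle>u, v\<rangle>"
  using qinner_add[of u v "\<ominus> v"]
  by (simp add: r_neg qinner_zero_right eq_neg_iff_add_eq_0 add.commute)

lemma qRe_commute:
  "\<lbrakk>u \<in> carrier H; v \<in> carrier H\<rbrakk> \<Longrightarrow> qRe \<langle>u, v\<rangle> = qRe \<langle>v, u\<rangle>"
  using qinner_cnj[of u v] by (metis qcnj_def quat.sel(1))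

lemma qRe_add:
  "\<lbrakk>u \<in> carrier H; v \<in> carrier H; w \<in> carrier H\<rbrakk>
    \<Longrightarrow> qRe \<langle>u, v \<oplus> w\<rangle> = qRe \<langle>u, v\<rangle> + qRe \<langle>u, w\<rangle>"
  by (simp add: qinner_add plus_quat_def)

lemma qRe_minus:
  "\<lbrakk>u \<in> carrier H; v \<in> carrier H\<rbrakk> \<Longrightarrow> qRe \<langle>u, \<ominus> v\<rangle> = - qRe \<langle>u, v\<rangle>"
  by (simp add: qinner_minus_right uminus_quat_def)

lemma qRe_rscale_real:
  "\<lbrakk>u \<in> carrier H; v \<in> carrier H\<rbrakk> \<Longrightarrow> qRe \<langle>u, v \<cdot> of_real r\<rangle> = r * qRe \<langle>u, v\<rangle>"
  by (simp add: qinner_rscale of_real_def scaleR_quat_def times_quat_def one_quat_def)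

lemma qRe_add_self:
  assumes "u \<in> carrier H" "v \<in> carrier H"
  shows "qRe \<langle>u \<oplus> v, u \<oplus> v\<rangle> = qRe \<langle>u, u\<rangle> + 2 * qRe \<langle>u, v\<rangle> + qRe \<langle>v, v\<rangle>"
  using assms qRe_commute[of "u \<oplus> v" u] qRe_commute[of "u \<oplus> v" v] qRe_commute[of u v]
  by (simp add: qRe_add)

lemma qRe_self_pos: "\<lbrakk>u \<in> carrier H; u \<noteq> \<zero>\<rbrakk> \<Longrightarrow> 0 < qRe \<langle>u, u\<rangle>"
  using qinner_pos[of u] by (auto simp: of_real_def scaleR_quat_def one_quat_def)

lemma qRe_self_nonneg: "u \<in> carrier H \<Longrightarrow> 0 \<le> qRe \<langle>u, u\<rangle>"
  using qRe_self_pos[of u] by (cases "u = \<zero>") (auto simp: qinner_zero_right zero_quat_def)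

lemma qnorm_nonneg: "u \<in> carrier H \<Longrightarrow> 0 \<le> qnorm H u"
  by (simp add: qnorm_def qRe_self_nonneg)

lemma qnorm_power2: "u \<in> carrier H \<Longrightarrow> (qnorm H u)\<^sup>2 = qRe \<langle>u, u\<rangle>"
  by (simp add: qnorm_def qRe_self_nonneg)

lemma qnorm_eq_zero_iff: "u \<in> carrier H \<Longrightarrow> qnorm H u = 0 \<longleftrightarrow> u = \<zero>"
  using qRe_self_pos[of u]
  by (cases "u = \<zero>") (auto simp: qnorm_def qinner_zero_right zero_quat_def)

lemma qnorm_minus: "u \<in> carrier H \<Longrightarrow> qnorm H (\<ominus> u) = qnorm H u"
  using qRe_commute[of u "\<ominus> u"] by (simp add: qnorm_def qRe_minus)

lemma qRe_le_qnorm: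
  assumes u: "u \<in> carrier H" and v: "v \<in> carrier H"
  shows "qRe \<langle>u, v\<rangle> \<le> qnorm H u * qnorm H v"
proof (cases "u = \<zero> \<or> v = \<zero>")
  case True
  then show ?thesis
    using u v qRe_commute[of u v]
    by (auto simp: qinner_zero_right qnorm_def zero_quat_def)
next
  case False
  define a where "a = qnorm H v"
  define b where "b = qnorm H u"
  define x where "x = u \<cdot> of_real a"
  define y where "y = v \<cdot> of_real (- b)"
  have c: "x \<in> carrier H" "y \<in> carrier H"
    using u v by (auto simp: x_def y_def)
  have pos: "0 < a * b"
    using False u v qnorm_nonneg qnorm_eq_zero_iff by (simp add: a_def b_def less_le)
  have xu: "qRe \<langle>x, w\<rangle> = a * qRe \<langle>u, w\<rangle>" if "w \<in> carrier H" for w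
    using qRe_rscale_real[of w u a] qRe_commute[of w x] qRe_commute[of w u] that u c
    by (simp add: x_def)
  have yv: "qRe \<langle>y, w\<rangle> = - b * qRe \<langle>v, w\<rangle>" if "w \<in> carrier H" for w
    using qRe_rscale_real[of w v "- b"] qRe_commute[of w y] qRe_commute[of w v] that v c
    by (simp add: y_def)
  have "qRe \<langle>x, x\<rangle> = a * (a * b\<^sup>2)"
    using xu[OF c(1)] qRe_rscale_real[OF u u, of a] qnorm_power2[OF u]
    by (simp add: x_def b_def)
  moreover have "qRe \<langle>y, y\<rangle> = b * (b * a\<^sup>2)"
    using yv[OF c(2)] qRe_rscale_real[OF v v, of "- b"] qnorm_power2[OF v]
    by (simp add: y_def a_def)
  moreover have "qRe \<langle>x, y\<rangle> = - (a * (b * qRe \<langle>u, v\<rangle>))"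
    using xu[OF c(2)] qRe_rscale_real[OF u v, of "- b"] by (simp add: y_def)
  moreover have "0 \<le> qRe \<langle>x \<oplus> y, x \<oplus> y\<rangle>"
    using c by (simp add: qRe_self_nonneg)
  ultimately have "0 \<le> 2 * (a * b) * (a * b - qRe \<langle>u, v\<rangle>)"
    using qRe_add_self[OF c] by (simp add: algebra_simps power2_eq_square)
  then have "0 \<le> a * b - qRe \<langle>u, v\<rangle>"
    using pos by (simp add: zero_le_mult_iff)
  then show ?thesis by (simp add: a_def b_def mult.commute)
qed

lemma qnorm_triangle:
  assumes "u \<in> carrier H" "v \<in> carrier H"
  shows "qnorm H (u \<oplus> v) \<le> qnorm H u + qnorm H v"
proof (rule power2_le_imp_le)
  show "(qnorm H (u \<oplus> v))\<^sup>2 \<le> (qnorm H u + qnorm H v)\<^sup>2"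
    using assms qRe_le_qnorm[OF assms] qRe_add_self[OF assms]
    by (simp add: power2_sum qnorm_power2)
  show "0 \<le> qnorm H u + qnorm H v"
    using assms qnorm_nonneg by simp
qed

lemma Metric_space_qdist: "Metric_space (carrier H) (qdist H)"
proof
  fix x y z
  show "0 \<le> qdist H x y"
    by (simp add: qdist_def qnorm_nonneg)
  show "qdist H x y = qdist H y x"
    using qnorm_minus[of "x \<ominus> y"]
    by (auto simp: qdist_def minus_add a_minus_def a_comm)
  assume xy: "x \<in> carrier H" "y \<in> carrier H"
  have "x \<ominus> y = \<zero> \<longleftrightarrow> x = y"
    using xy by (metis a_minus_def a_inv_closed minus_equality minus_minus r_neg)
  then show "qdist H x y = 0 \<longleftrightarrow> x = y"
    using xy by (simp add: qdist_def qnorm_eq_zero_iff)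
  assume z: "z \<in> carrier H"
  have "x \<ominus> z = (x \<ominus> y) \<oplus> (y \<ominus> z)"
    using xy z by (simp add: a_minus_def a_assoc r_neg1)
  then show "qdist H x z \<le> qdist H x y + qdist H y z"
    using qnorm_triangle[of "x \<ominus> y" "y \<ominus> z"] xy z by (simp add: qdist_def)
qed

end


section \<open>Operators, subspaces and projections\<close>

definition right_linear ::
    "('a, 'm) quat_space_scheme \<Rightarrow> ('b, 'n) quat_space_scheme \<Rightarrow> ('a \<Rightarrow> 'b) \<Rightarrow> bool" where
  "right_linear H G T \<longleftrightarrow> T \<in> carrier H \<rightarrow> carrier G \<and>
    (\<forall>u\<in>carrier H. \<forall>v\<in>carrier H. \<forall>p q.
       T (u \<cdot>\<^bsub>H\<^esub> p \<oplus>\<^bsub>H\<^esub> v \<cdot>\<^bsub>H\<^esub> q) = T u \<cdot>\<^bsub>G\<^esub> p \<oplus>\<^bsub>G\<^esub> T v \<cdot>\<^bsub>G\<^esub> q)"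

definition bounded_op ::
    "('a, 'm) quat_space_scheme \<Rightarrow> ('b, 'n) quat_space_scheme \<Rightarrow> ('a \<Rightarrow> 'b) \<Rightarrow> bool" where
  "bounded_op H G T \<longleftrightarrow> (\<exists>K>0. \<forall>v\<in>carrier H. qnorm G (T v) \<le> K * qnorm H v)"

definition bounded_right_linear ::
    "('a, 'm) quat_space_scheme \<Rightarrow> ('b, 'n) quat_space_scheme \<Rightarrow> ('a \<Rightarrow> 'b) \<Rightarrow> bool" where
  "bounded_right_linear H G T \<longleftrightarrow> right_linear H G T \<and> bounded_op H G T"

definition invertible_op :: "('a, 'm) quat_space_scheme \<Rightarrow> ('a \<Rightarrow> 'a) \<Rightarrow> bool" where
  "invertible_op H T \<longleftrightarrow>
    bij_betw T (carrier H) (carrier H) \<and> bounded_op H H (inv_into (carrier H) T)"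

definition adjoint_op :: "('a, 'm) quat_space_scheme \<Rightarrow> ('a \<Rightarrow> 'a) \<Rightarrow> 'a \<Rightarrow> 'a" where
  "adjoint_op H T v =
    (THE w. w \<in> carrier H \<and> (\<forall>u\<in>carrier H. \<langle>v, T u\<rangle>\<^bsub>H\<^esub> = \<langle>w, u\<rangle>\<^bsub>H\<^esub>))"

definition closed_subspace :: "('a, 'm) quat_space_scheme \<Rightarrow> 'a set \<Rightarrow> bool" where
  "closed_subspace H W \<longleftrightarrow> additive_subgroup W H \<and>
    (\<forall>w\<in>W. \<forall>q. w \<cdot>\<^bsub>H\<^esub> q \<in> W) \<and> closedin (qtopology H) W"

definition proj :: "('a, 'm) quat_space_scheme \<Rightarrow> 'a set \<Rightarrow> 'a \<Rightarrow> 'a" where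
  "proj H W f = (THE g. g \<in> W \<and> (\<forall>w\<in>W. \<langle>w, f \<ominus>\<^bsub>H\<^esub> g\<rangle>\<^bsub>H\<^esub> = 0))"


section \<open>Frames\<close>

text \<open>
  Convergence of the series is stated separately, since \<^const>\<open>infsum\<close> of a family that is not
  summable is \<open>0\<close>.
\<close>

definition g_fusion_frame ::
    "('a, 'm) quat_space_scheme \<Rightarrow> (int \<Rightarrow> ('b, 'n) quat_space_scheme) \<Rightarrow> int set \<Rightarrow>
     (int \<Rightarrow> 'a set) \<Rightarrow> (int \<Rightarrow> 'a \<Rightarrow> 'b) \<Rightarrow> (int \<Rightarrow> real) \<Rightarrow> real \<Rightarrow> real \<Rightarrow> bool" where
  "g_fusion_frame H Hs J W \<Lambda> v A B \<longleftrightarrow>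
    (\<forall>j\<in>J. closed_subspace H (W j) \<and> bounded_right_linear H (Hs j) (\<Lambda> j) \<and> 0 < v j) \<and>
    0 < A \<and> A \<le> B \<and>
    (\<forall>f\<in>carrier H.
       (\<lambda>j. (v j)\<^sup>2 * (qnorm (Hs j) (\<Lambda> j (proj H (W j) f)))\<^sup>2) summable_on J \<and>
       A * (qnorm H f)\<^sup>2 \<le> (\<Sum>\<^sub>\<infinity>j\<in>J. (v j)\<^sup>2 * (qnorm (Hs j) (\<Lambda> j (proj H (W j) f)))\<^sup>2) \<and>
       (\<Sum>\<^sub>\<infinity>j\<in>J. (v j)\<^sup>2 * (qnorm (Hs j) (\<Lambda> j (proj H (W j) f)))\<^sup>2) \<le> B * (qnorm H f)\<^sup>2)"

definition K_g_fusion_frame ::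
    "('a, 'm) quat_space_scheme \<Rightarrow> (int \<Rightarrow> ('b, 'n) quat_space_scheme) \<Rightarrow> int set \<Rightarrow>
     ('a \<Rightarrow> 'a) \<Rightarrow> (int \<Rightarrow> 'a set) \<Rightarrow> (int \<Rightarrow> 'a \<Rightarrow> 'b) \<Rightarrow> (int \<Rightarrow> real) \<Rightarrow> bool" where
  "K_g_fusion_frame H Hs J K V \<Theta> v \<longleftrightarrow>
    bounded_right_linear H H K \<and>
    (\<forall>j\<in>J. closed_subspace H (V j) \<and> bounded_right_linear H (Hs j) (\<Theta> j) \<and> 0 < v j) \<and>
    (\<exists>A B. 0 < A \<and> A \<le> B \<and>
      (\<forall>f\<in>carrier H.
         (\<lambda>j. (v j)\<^sup>2 * (qnorm (Hs j) (\<Theta> j (proj H (V j) f)))\<^sup>2) summable_on J \<and>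
         A * (qnorm H (adjoint_op H K f))\<^sup>2
           \<le> (\<Sum>\<^sub>\<infinity>j\<in>J. (v j)\<^sup>2 * (qnorm (Hs j) (\<Theta> j (proj H (V j) f)))\<^sup>2) \<and>
         (\<Sum>\<^sub>\<infinity>j\<in>J. (v j)\<^sup>2 * (qnorm (Hs j) (\<Theta> j (proj H (V j) f)))\<^sup>2) \<le> B * (qnorm H f)\<^sup>2))"

end

theory Submission
  imports Defs
begin

text \<open>
  Write \<open>P\<^sub>W\<close> for the orthogonal projection onto \<open>W\<close>. For \<open>f \<in> H\<close> the vector \<open>f - P\<^bsub>U W\<^esub> f\<close> is
  orthogonal to \<open>U W\<close>, so \<open>U\<^sup>*\<close> sends it into the orthogonal complement of \<open>W\<close>; therefore
  \<open>P\<^sub>W U\<^sup>* P\<^bsub>U W\<^esub> = P\<^sub>W U\<^sup>*\<close> (\<open>proj_adjoint_op_proj_image\<close>). Hence the terms of the new frame at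
  \<open>f\<close> are exactly the terms of the old frame at \<open>U\<^sup>* f\<close>, and the old bounds give

  \<open>A \<parallel>U\<^sup>* f\<parallel>\<^sup>2 \<le> \<Sum>\<^sub>j v\<^sub>j\<^sup>2 \<parallel>\<Lambda>\<^sub>j P\<^sub>j U\<^sup>* Q\<^sub>j f\<parallel>\<^sup>2 \<le> B \<parallel>U\<^sup>* f\<parallel>\<^sup>2\<close>,

  where \<open>P\<^sub>j\<close> and \<open>Q\<^sub>j\<close> project onto \<open>W\<^sub>j\<close> and \<open>U W\<^sub>j\<close>. Let \<open>K, L > 0\<close> bound \<open>U\<close> and \<open>U\<^sup>*\<close>. The
  operator \<open>U U\<^sup>*\<close> is its own adjoint and \<open>\<parallel>U U\<^sup>* f\<parallel> \<le> K \<parallel>U\<^sup>* f\<parallel>\<close>, which yields the lower bound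
  with constant \<open>A / K\<^sup>2\<close>; the upper bound holds with \<open>B L\<^sup>2\<close>. Each \<open>U W\<^sub>j\<close> is closed because \<open>U\<close>
  is invertible (\<open>closed_subspace_image\<close>).

  Adjoints and projections are both defined by descriptions, so their existence has to be
  established. Both are instances of Riesz representation on a closed subspace
  (\<open>riesz_on_closed_subspace\<close>), and both are restrictions of an adjoint
  (\<open>restricted_adjoint_bounded_right_linear\<close>), which makes them bounded and right linear.
\<close>

section \<open>Quaternionic inner product algebra\<close>

lemma quat_eqI_Re:
  assumes "\<And>q. qRe (a * q) = qRe (b * q)"
  shows "a = b"
  using assms[of "Quat 1 0 0 0"] assms[of "Quat 0 1 0 0"]
    assms[of "Quat 0 0 1 0"] assms[of "Quat 0 0 0 1"]
  by (simp add: quat_eq_iff times_quat_def)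

lemma qcnj_add: "qcnj (p + q) = qcnj p + qcnj q"
  by (simp add: qcnj_def plus_quat_def)

lemma qcnj_mult: "qcnj (p * q) = qcnj q * qcnj p"
  by (simp add: qcnj_def times_quat_def algebra_simps)

sublocale right_quat_inner_space \<subseteq> metric: Metric_space "carrier H" "qdist H"
  by (rule Metric_space_qdist)

context right_quat_inner_space
begin

lemma rscale_zero_right: "u \<in> carrier H \<Longrightarrow> u \<cdot> 0 = \<zero>"
  using rscale_add_right[of u 0 0] by simp

lemma qinner_add_left:
  assumes "u \<in> carrier H" "v \<in> carrier H" "w \<in> carrier H"
  shows "\<langle>u \<oplus> v, w\<rangle> = \<langle>u, w\<rangle> + \<langle>v, w\<rangle>"
  using assms by (metis add.m_closed qcnj_add qinner_add qinner_cnj)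

lemma qinner_rscale_left:
  assumes "u \<in> carrier H" "v \<in> carrier H"
  shows "\<langle>u \<cdot> q, v\<rangle> = qcnj q * \<langle>u, v\<rangle>"
  using assms by (metis qcnj_mult qinner_cnj qinner_rscale rscale_closed)

lemma qinner_diff_right:
  assumes "u \<in> carrier H" "v \<in> carrier H" "w \<in> carrier H"
  shows "\<langle>u, v \<ominus> w\<rangle> = \<langle>u, v\<rangle> - \<langle>u, w\<rangle>"
  using assms by (simp add: a_minus_def qinner_add qinner_minus_right)

lemma diff_eq_zero_iff:
  assumes "u \<in> carrier H" "v \<in> carrier H"
  shows "u \<ominus> v = \<zero> \<longleftrightarrow> u = v"
  using assms metric.zero[of u v] by (simp add: qdist_def qnorm_eq_zero_iff)

lemma qnorm_diff_power2:
  assumes "u \<in> carrier H" "v \<in> carrier H"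
  shows "(qnorm H (u \<ominus> v))\<^sup>2 = qRe \<langle>u, u\<rangle> - 2 * qRe \<langle>u, v\<rangle> + qRe \<langle>v, v\<rangle>"
proof -
  have "qRe \<langle>\<ominus> v, \<ominus> v\<rangle> = qRe \<langle>v, v\<rangle>"
    using assms qnorm_minus[of v] qnorm_power2[of v] qnorm_power2[of "\<ominus> v"] by simp
  then show ?thesis
    using assms by (simp add: a_minus_def qnorm_power2 qRe_add_self qRe_minus)
qed

lemma subspace_qinner_eqI:
  assumes W: "additive_subgroup W H" and "x \<in> W" "y \<in> W"
    and eq: "\<And>w. w \<in> W \<Longrightarrow> \<langle>x, w\<rangle> = \<langle>y, w\<rangle>"
  shows "x = y"
proof -
  interpret additive_subgroup W H by (rule W)
  have c: "x \<in> carrier H" "y \<in> carrier H" using assms by auto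
  have mem: "x \<ominus> y \<in> W"
    using \<open>x \<in> W\<close> \<open>y \<in> W\<close> by (simp add: a_minus_def)
  have "qRe \<langle>x \<ominus> y, x \<ominus> y\<rangle> = qRe \<langle>x \<ominus> y, x\<rangle> - qRe \<langle>x \<ominus> y, y\<rangle>"
    using c by (simp add: qinner_diff_right minus_quat_def)
  also have "\<dots> = qRe \<langle>x, x \<ominus> y\<rangle> - qRe \<langle>y, x \<ominus> y\<rangle>"
    using c qRe_commute[of "x \<ominus> y"] by simp
  also have "\<dots> = 0" using eq[OF mem] by simp
  finally have "x \<ominus> y = \<zero>"
    using qRe_self_pos[of "x \<ominus> y"] c by fastforce
  then show ?thesis using c by (simp add: diff_eq_zero_iff)
qed

lemma closed_subspace_carrier: "closed_subspace H (carrier H)"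
proof -
  have "additive_subgroup (carrier H) H"
    unfolding additive_subgroup_def
    using group.subgroup_self[OF a_group] by simp
  then show ?thesis
    using closedin_topspace[of metric.mtopology] by (simp add: closed_subspace_def)
qed

end


section \<open>Riesz representation on a closed subspace\<close>

context right_quat_hilbert_space
begin

text \<open>
  The representing vector minimizes the functional \<open>g w = \<parallel>w\<parallel>\<^sup>2 - 2 Re (\<phi> w)\<close> on \<open>W\<close>. By the
  parallelogram law \<open>\<parallel>a - b\<parallel>\<^sup>2 = 2 g a + 2 g b - 4 g ((a + b) / 2)\<close>, hence a minimizing sequence is
  Cauchy, and the first variation of \<open>g\<close> vanishes at its limit. This one statement yields both
  projections (\<open>\<phi> = \<langle>f, \<cdot>\<rangle>\<close> on \<open>W\<close>) and adjoints (\<open>\<phi> = \<langle>f, T \<cdot>\<rangle>\<close> on the whole space).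
\<close>

lemma riesz_on_closed_subspace:
  assumes W: "closed_subspace H W"
    and add: "\<And>u v. \<lbrakk>u \<in> W; v \<in> W\<rbrakk> \<Longrightarrow> \<phi> (u \<oplus> v) = \<phi> u + \<phi> v"
    and scale: "\<And>u q. u \<in> W \<Longrightarrow> \<phi> (u \<cdot> q) = \<phi> u * q"
    and bound: "\<And>u. u \<in> W \<Longrightarrow> qRe (\<phi> u) \<le> C * qnorm H u"
  shows "\<exists>!w. w \<in> W \<and> (\<forall>u\<in>W. \<langle>w, u\<rangle> = \<phi> u)"
proof -
  have sub: "additive_subgroup W H"
    and Wscale: "\<And>w q. w \<in> W \<Longrightarrow> w \<cdot> q \<in> W"
    and Wclosed: "closedin metric.mtopology W"
    using W by (auto simp: closed_subspace_def)
  interpret additive_subgroup W H by (rule sub)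
  have car: "u \<in> carrier H" if "u \<in> W" for u using that by auto
  have scaleR: "qRe (\<phi> (u \<cdot> of_real t)) = t * qRe (\<phi> u)" if "u \<in> W" for u t
    using that by (simp add: scale of_real_def scaleR_quat_def times_quat_def one_quat_def)
  define g where "g w = qRe \<langle>w, w\<rangle> - 2 * qRe (\<phi> w)" for w
  have lower: "- C\<^sup>2 \<le> g w" if "w \<in> W" for w
  proof -
    have "0 \<le> (qnorm H w - C)\<^sup>2" by simp
    then show ?thesis
      using bound[OF that] qnorm_power2[OF car[OF that]]
      by (simp add: g_def power2_diff algebra_simps)
  qed
  have variation: "g (w \<oplus> u \<cdot> of_real t)
      = g w + 2 * t * (qRe \<langle>w, u\<rangle> - qRe (\<phi> u)) + t\<^sup>2 * qRe \<langle>u, u\<rangle>"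
    if "w \<in> W" "u \<in> W" for w u t
  proof -
    have c: "w \<in> carrier H" "u \<in> carrier H" using that car by auto
    have "qRe \<langle>u \<cdot> of_real t, u \<cdot> of_real t\<rangle> = t\<^sup>2 * qRe \<langle>u, u\<rangle>"
      using c qRe_rscale_real[of "u \<cdot> of_real t" u t] qRe_rscale_real[of u u t]
        qRe_commute[of "u \<cdot> of_real t" u]
      by (simp add: power2_eq_square)
    then show ?thesis
      using c that add[of w "u \<cdot> of_real t"] Wscale
      by (simp add: g_def qRe_add_self qRe_rscale_real scaleR plus_quat_def algebra_simps)
  qed
  define m where "m = Inf (g ` W)"
  have bdd: "bdd_below (g ` W)" using lower by (rule bdd_belowI2)
  have ne: "g ` W \<noteq> {}" using zero_closed by blast
  have m_le: "m \<le> g w" if "w \<in> W" for w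
    using bdd that by (auto simp: m_def intro: cInf_lower)
  define \<delta> where "\<delta> n = inverse (real (Suc n))" for n
  have \<delta>_pos: "0 < \<delta> n" for n by (simp add: \<delta>_def)
  have \<delta>_lim: "\<delta> \<longlonglongrightarrow> 0"
    unfolding \<delta>_def using LIMSEQ_inverse_real_of_nat by simp
  have "\<exists>w\<in>W. g w < m + \<delta> n" for n
    using cInf_lessD[OF ne, of "m + \<delta> n"] \<delta>_pos[of n] by (auto simp: m_def)
  then obtain s where s: "\<And>n. s n \<in> W" and sg: "\<And>n. g (s n) < m + \<delta> n"
    by metis
  have parallelogram: "(qnorm H (a \<ominus> b))\<^sup>2 \<le> 2 * (g a - m) + 2 * (g b - m)"
    if a: "a \<in> W" and b: "b \<in> W" for a b
  proof -
    have c: "a \<in> carrier H" "b \<in> carrier H" using that car by auto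
    \<comment> \<open>The midpoint is reached from the origin, so that the first variation formula computes \<open>g\<close> there.\<close>
    define h where "h = \<zero> \<oplus> (a \<oplus> b) \<cdot> of_real (1/2)"
    have \<phi>0: "qRe (\<phi> \<zero>) = 0"
      using add[OF zero_closed zero_closed] by (simp add: zero_quat_def)
    have "h \<in> W" using a b Wscale by (simp add: h_def)
    then have "m \<le> g h" by (rule m_le)
    moreover have "g h = - qRe (\<phi> (a \<oplus> b)) + qRe \<langle>a \<oplus> b, a \<oplus> b\<rangle> / 4"
      using variation[of \<zero> "a \<oplus> b" "1/2"] a b c \<phi>0 qRe_commute[of \<zero> "a \<oplus> b"]
      by (simp add: h_def g_def qinner_zero_right zero_quat_def power2_eq_square)
    ultimately show ?thesis
      using c qRe_add_self[of a b] add[OF a b] qnorm_diff_power2[of a b]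
      by (simp add: g_def plus_quat_def algebra_simps)
  qed
  have "metric.MCauchy s"
    unfolding metric.MCauchy_def
  proof (intro conjI allI impI)
    show "range s \<subseteq> carrier H" using s car by auto
    fix e :: real assume e: "0 < e"
    then have "eventually (\<lambda>n. \<delta> n < e\<^sup>2 / 4) sequentially"
      using order_tendstoD(2)[OF \<delta>_lim, of "e\<^sup>2 / 4"] by simp
    then obtain N where N: "\<And>n. n \<ge> N \<Longrightarrow> \<delta> n < e\<^sup>2 / 4"
      by (auto simp: eventually_sequentially)
    show "\<exists>N. \<forall>n n'. N \<le> n \<longrightarrow> N \<le> n' \<longrightarrow> qdist H (s n) (s n') < e"
    proof (intro exI allI impI)
      fix n n' assume n: "N \<le> n" "N \<le> n'"
      have "(qnorm H (s n \<ominus> s n'))\<^sup>2 \<le> 2 * (g (s n) - m) + 2 * (g (s n') - m)"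
        by (rule parallelogram[OF s s])
      also have "\<dots> < e\<^sup>2"
        using sg[of n] sg[of n'] N[OF n(1)] N[OF n(2)] by (simp add: field_simps)
      finally have "(qnorm H (s n \<ominus> s n'))\<^sup>2 < e\<^sup>2" .
      then have "qnorm H (s n \<ominus> s n') < e"
        using e by (simp add: power2_less_imp_less)
      then show "qdist H (s n) (s n') < e"
        using s car by (simp add: qdist_def)
    qed
  qed
  then obtain w where lim: "limitin metric.mtopology s w sequentially"
    using complete by (auto simp: metric.mcomplete_def)
  have w: "w \<in> W"
    using lim Wclosed s metric.metric_closedin_iff_sequentially_closed by blast
  have dist_lim: "(\<lambda>n. qnorm H (s n \<ominus> w)) \<longlonglongrightarrow> 0"
    using lim s car w by (simp add: metric.limitin_metric_dist_null qdist_def)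
  have Re_eq: "qRe \<langle>w, u\<rangle> = qRe (\<phi> u)" if u: "u \<in> W" for u
  proof -
    have "(\<lambda>n. qRe \<langle>s n, u\<rangle>) \<longlonglongrightarrow> qRe \<langle>w, u\<rangle>"
    proof (rule LIM_zero_cancel, rule Lim_null_comparison)
      have "\<bar>qRe \<langle>s n, u\<rangle> - qRe \<langle>w, u\<rangle>\<bar> \<le> qnorm H (s n \<ominus> w) * qnorm H u" for n
      proof -
        have c: "s n \<in> carrier H" "w \<in> carrier H" "u \<in> carrier H" using s w u car by auto
        have "qRe \<langle>s n, u\<rangle> - qRe \<langle>w, u\<rangle> = qRe \<langle>u, s n \<ominus> w\<rangle>"
          using c qRe_commute[of u] by (simp add: qinner_diff_right minus_quat_def)
        moreover have "\<bar>qRe \<langle>u, s n \<ominus> w\<rangle>\<bar> \<le> qnorm H (s n \<ominus> w) * qnorm H u"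
          using c qRe_le_qnorm[of u "s n \<ominus> w"] qRe_le_qnorm[of u "\<ominus> (s n \<ominus> w)"]
          by (simp add: qRe_minus qnorm_minus mult.commute abs_le_iff)
        ultimately show ?thesis by simp
      qed
      then show "\<forall>\<^sub>F n in sequentially.
          norm (qRe \<langle>s n, u\<rangle> - qRe \<langle>w, u\<rangle>) \<le> qnorm H (s n \<ominus> w) * qnorm H u"
        by simp
      show "(\<lambda>n. qnorm H (s n \<ominus> w) * qnorm H u) \<longlonglongrightarrow> 0"
        using tendsto_mult_left_zero[OF dist_lim] by simp
    qed
    then have lim_c: "(\<lambda>n. \<delta> n + 2 * t * (qRe \<langle>s n, u\<rangle> - qRe (\<phi> u)) + t\<^sup>2 * qRe \<langle>u, u\<rangle>)
        \<longlonglongrightarrow> 0 + 2 * t * (qRe \<langle>w, u\<rangle> - qRe (\<phi> u)) + t\<^sup>2 * qRe \<langle>u, u\<rangle>" for t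
      by (intro tendsto_intros \<delta>_lim)
    define c where "c = qRe \<langle>w, u\<rangle> - qRe (\<phi> u)"
    define r where "r = qRe \<langle>u, u\<rangle>"
    have nonneg: "0 \<le> 2 * t * c + t\<^sup>2 * r" for t
    proof -
      have "0 \<le> \<delta> n + 2 * t * (qRe \<langle>s n, u\<rangle> - qRe (\<phi> u)) + t\<^sup>2 * qRe \<langle>u, u\<rangle>" for n
        using m_le[of "s n \<oplus> u \<cdot> of_real t"] variation[OF s[of n] u, of t] sg[of n]
          s[of n] u Wscale by simp
      then show ?thesis
        using LIMSEQ_le_const[OF lim_c[of t], of 0] by (auto simp: c_def r_def)
    qed
    have r: "0 \<le> r" using u car by (simp add: r_def qRe_self_nonneg)
    \<comment> \<open>A quadratic polynomial without constant term is nonnegative only if its linear term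
      vanishes; this \<open>t\<close> makes it negative otherwise, also for \<open>r = 0\<close>.\<close>
    define t where "t = - c / (r + 1)"
    have t: "t * (r + 1) = - c" using r by (simp add: t_def)
    have "0 \<le> (2 * t * c + t\<^sup>2 * r) * (r + 1)\<^sup>2"
      using nonneg[of t] by simp
    also have "\<dots> = 2 * c * (t * (r + 1)) * (r + 1) + (t * (r + 1))\<^sup>2 * r"
      by (simp add: power2_eq_square algebra_simps)
    also have "\<dots> = - (c\<^sup>2 * (r + 2))"
      unfolding t by (simp add: power2_eq_square algebra_simps)
    finally have "c\<^sup>2 * (r + 2) \<le> 0" by simp
    then have "c = 0" using r by (simp add: mult_le_0_iff)
    then show ?thesis by (simp add: c_def)
  qed
  have "\<langle>w, u\<rangle> = \<phi> u" if u: "u \<in> W" for u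
  proof (rule quat_eqI_Re)
    fix q
    show "qRe (\<langle>w, u\<rangle> * q) = qRe (\<phi> u * q)"
      using Re_eq[OF Wscale[OF u, of q]] u w car by (simp add: scale qinner_rscale)
  qed
  then show ?thesis
    using w subspace_qinner_eqI[OF sub] by (intro ex1I[of _ w]) auto
qed

end


section \<open>Bounded operators\<close>

lemma bounded_right_linear_closed:
  "\<lbrakk>bounded_right_linear H G T; u \<in> carrier H\<rbrakk> \<Longrightarrow> T u \<in> carrier G"
  by (auto simp: bounded_right_linear_def right_linear_def)

lemma bounded_right_linear_comp:
  assumes T: "bounded_right_linear H G T" and S: "bounded_right_linear G F S"
  shows "bounded_right_linear H F (S \<circ> T)"
proof -
  obtain K where K: "0 < K" "\<And>u. u \<in> carrier H \<Longrightarrow> qnorm G (T u) \<le> K * qnorm H u"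
    using T by (auto simp: bounded_right_linear_def bounded_op_def)
  obtain L where L: "0 < L" "\<And>u. u \<in> carrier G \<Longrightarrow> qnorm F (S u) \<le> L * qnorm G u"
    using S by (auto simp: bounded_right_linear_def bounded_op_def)
  have "qnorm F (S (T u)) \<le> (L * K) * qnorm H u" if u: "u \<in> carrier H" for u
  proof -
    have "qnorm F (S (T u)) \<le> L * qnorm G (T u)"
      using L(2) bounded_right_linear_closed[OF T u] .
    also have "\<dots> \<le> L * (K * qnorm H u)"
      using K(2)[OF u] L(1) by simp
    finally show ?thesis by (simp add: mult.assoc)
  qed
  moreover have "0 < L * K" using K(1) L(1) by simp
  ultimately have "bounded_op H F (S \<circ> T)"
    unfolding bounded_op_def comp_def by blast
  moreover have "right_linear H F (S \<circ> T)"
    using S T by (auto simp: bounded_right_linear_def right_linear_def Pi_iff)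
  ultimately show ?thesis by (simp add: bounded_right_linear_def)
qed

context right_quat_inner_space
begin

lemma bounded_right_linear_id: "bounded_right_linear H H (\<lambda>u. u)"
  by (auto simp: bounded_right_linear_def right_linear_def bounded_op_def intro: exI[of _ 1])

lemma right_linear_add:
  assumes "right_linear H H T" "u \<in> carrier H" "v \<in> carrier H"
  shows "T (u \<oplus> v) = T u \<oplus> T v"
proof -
  have "T (u \<cdot> 1 \<oplus> v \<cdot> 1) = T u \<cdot> 1 \<oplus> T v \<cdot> 1"
    using assms unfolding right_linear_def by blast
  moreover have "T u \<in> carrier H" "T v \<in> carrier H"
    using assms by (auto simp: right_linear_def)
  ultimately show ?thesis using assms by simp
qed

lemma right_linear_rscale:
  assumes "right_linear H H T" "u \<in> carrier H"
  shows "T (u \<cdot> q) = T u \<cdot> q"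
proof -
  have "T (u \<cdot> q \<oplus> u \<cdot> 0) = T u \<cdot> q \<oplus> T u \<cdot> 0"
    using assms unfolding right_linear_def by blast
  moreover have "T u \<in> carrier H"
    using assms by (auto simp: right_linear_def)
  ultimately show ?thesis using assms by (simp add: rscale_zero_right)
qed

lemma right_linear_abelian_group_hom:
  assumes "right_linear H H T"
  shows "abelian_group_hom H H T"
  using assms right_linear_add[OF assms]
  by unfold_locales (auto simp: hom_def right_linear_def)

lemma right_linear_diff:
  assumes "right_linear H H T" "u \<in> carrier H" "v \<in> carrier H"
  shows "T (u \<ominus> v) = T u \<ominus> T v"
proof -
  interpret T: abelian_group_hom H H T
    by (rule right_linear_abelian_group_hom) (rule assms)
  show ?thesis using assms by (simp add: a_minus_def)
qed

end

context right_quat_hilbert_space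
begin

text \<open>
  Such an \<open>S\<close> is the adjoint of \<open>T\<close> restricted to \<open>W\<close>. The orthogonal projection onto \<open>W\<close> is the
  case \<open>T = id\<close>, so projections and adjoints inherit linearity and boundedness from one argument.
\<close>

lemma restricted_adjoint_bounded_right_linear:
  assumes W: "closed_subspace H W" and T: "bounded_right_linear H H T"
    and S: "\<And>f. f \<in> carrier H \<Longrightarrow> S f \<in> W"
    and adj: "\<And>f u. \<lbrakk>f \<in> carrier H; u \<in> W\<rbrakk> \<Longrightarrow> \<langle>S f, u\<rangle> = \<langle>f, T u\<rangle>"
  shows "bounded_right_linear H H S"
proof -
  have sub: "additive_subgroup W H" and Wscale: "\<And>w q. w \<in> W \<Longrightarrow> w \<cdot> q \<in> W"
    using W by (auto simp: closed_subspace_def)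
  interpret additive_subgroup W H by (rule sub)
  have car: "u \<in> carrier H" if "u \<in> W" for u using that by auto
  note Tc = bounded_right_linear_closed[OF T]
  obtain K where K: "0 < K" "\<And>u. u \<in> carrier H \<Longrightarrow> qnorm H (T u) \<le> K * qnorm H u"
    using T by (auto simp: bounded_right_linear_def bounded_op_def)
  have "S (f \<cdot> p \<oplus> g \<cdot> q) = S f \<cdot> p \<oplus> S g \<cdot> q"
    if f: "f \<in> carrier H" and g: "g \<in> carrier H" for f g p q
  proof (rule subspace_qinner_eqI[OF sub])
    show "S (f \<cdot> p \<oplus> g \<cdot> q) \<in> W" "S f \<cdot> p \<oplus> S g \<cdot> q \<in> W"
      using f g S Wscale by auto
    fix w assume w: "w \<in> W"
    show "\<langle>S (f \<cdot> p \<oplus> g \<cdot> q), w\<rangle> = \<langle>S f \<cdot> p \<oplus> S g \<cdot> q, w\<rangle>"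
      using f g w car S Tc by (simp add: adj qinner_add_left qinner_rscale_left)
  qed
  then have "right_linear H H S"
    using S car by (auto simp: right_linear_def)
  moreover have "qnorm H (S f) \<le> K * qnorm H f" if f: "f \<in> carrier H" for f
  proof (cases "qnorm H (S f) = 0")
    case True
    then show ?thesis using K(1) qnorm_nonneg[OF f] by simp
  next
    case False
    have c: "S f \<in> carrier H" using S f car by auto
    have "(qnorm H (S f))\<^sup>2 = qRe \<langle>f, T (S f)\<rangle>"
      using c f S by (simp add: qnorm_power2 adj)
    also have "\<dots> \<le> qnorm H f * qnorm H (T (S f))"
      using f c Tc qRe_le_qnorm by simp
    also have "\<dots> \<le> qnorm H f * (K * qnorm H (S f))"
      using K(2)[OF c] qnorm_nonneg[OF f] by (rule mult_left_mono)
    finally have "qnorm H (S f) * qnorm H (S f) \<le> (K * qnorm H f) * qnorm H (S f)"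
      by (simp add: power2_eq_square mult_ac)
    then show ?thesis
      using False qnorm_nonneg[OF c] by simp
  qed
  ultimately show ?thesis
    using K(1) by (auto simp: bounded_right_linear_def bounded_op_def)
qed

lemma restricted_adjoint_ex1:
  assumes W: "closed_subspace H W" and T: "bounded_right_linear H H T" and f: "f \<in> carrier H"
  shows "\<exists>!w. w \<in> W \<and> (\<forall>u\<in>W. \<langle>w, u\<rangle> = \<langle>f, T u\<rangle>)"
proof -
  have sub: "additive_subgroup W H"
    using W by (auto simp: closed_subspace_def)
  interpret additive_subgroup W H by (rule sub)
  have car: "u \<in> carrier H" if "u \<in> W" for u using that by auto
  note Tc = bounded_right_linear_closed[OF T]
  have lin: "right_linear H H T" using T by (simp add: bounded_right_linear_def)
  obtain K where K: "0 < K" "\<And>u. u \<in> carrier H \<Longrightarrow> qnorm H (T u) \<le> K * qnorm H u"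
    using T by (auto simp: bounded_right_linear_def bounded_op_def)
  show ?thesis
  proof (rule riesz_on_closed_subspace[OF W])
    show "\<langle>f, T (u \<oplus> v)\<rangle> = \<langle>f, T u\<rangle> + \<langle>f, T v\<rangle>" if "u \<in> W" "v \<in> W" for u v
      using that car f Tc by (simp add: right_linear_add[OF lin] qinner_add)
    show "\<langle>f, T (u \<cdot> q)\<rangle> = \<langle>f, T u\<rangle> * q" if "u \<in> W" for u q
      using that car f Tc by (simp add: right_linear_rscale[OF lin] qinner_rscale)
    show "qRe \<langle>f, T u\<rangle> \<le> (qnorm H f * K) * qnorm H u" if "u \<in> W" for u
    proof -
      have "qRe \<langle>f, T u\<rangle> \<le> qnorm H f * qnorm H (T u)"
        using that car f Tc qRe_le_qnorm by simp
      also have "\<dots> \<le> qnorm H f * (K * qnorm H u)"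
        using K(2)[OF car[OF that]] qnorm_nonneg[OF f] by (rule mult_left_mono)
      finally show ?thesis by (simp add: mult.assoc)
    qed
  qed
qed

lemma
  assumes T: "bounded_right_linear H H T" and f: "f \<in> carrier H"
  shows adjoint_op_closed: "adjoint_op H T f \<in> carrier H"
    and qinner_adjoint_op: "u \<in> carrier H \<Longrightarrow> \<langle>adjoint_op H T f, u\<rangle> = \<langle>f, T u\<rangle>"
proof -
  have "\<exists>!w. w \<in> carrier H \<and> (\<forall>u\<in>carrier H. \<langle>f, T u\<rangle> = \<langle>w, u\<rangle>)"
    using restricted_adjoint_ex1[OF closed_subspace_carrier T f] by (simp add: eq_commute)
  from theI'[OF this, folded adjoint_op_def]
  show "adjoint_op H T f \<in> carrier H"
    and "u \<in> carrier H \<Longrightarrow> \<langle>adjoint_op H T f, u\<rangle> = \<langle>f, T u\<rangle>"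
    by auto
qed

lemma adjoint_op_eqI:
  assumes T: "bounded_right_linear H H T" and f: "f \<in> carrier H" and w: "w \<in> carrier H"
    and eq: "\<And>u. u \<in> carrier H \<Longrightarrow> \<langle>w, u\<rangle> = \<langle>f, T u\<rangle>"
  shows "adjoint_op H T f = w"
  using closed_subspace_carrier subspace_qinner_eqI[of "carrier H" "adjoint_op H T f" w]
    adjoint_op_closed[OF T f] qinner_adjoint_op[OF T f] w eq
  by (simp add: closed_subspace_def)

lemma bounded_right_linear_adjoint_op:
  assumes T: "bounded_right_linear H H T"
  shows "bounded_right_linear H H (adjoint_op H T)"
  using closed_subspace_carrier T
  by (rule restricted_adjoint_bounded_right_linear)
    (simp_all add: adjoint_op_closed[OF T] qinner_adjoint_op[OF T])

lemma qinner_adjoint_op_right: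
  assumes T: "bounded_right_linear H H T" and f: "f \<in> carrier H" and u: "u \<in> carrier H"
  shows "\<langle>u, adjoint_op H T f\<rangle> = \<langle>T u, f\<rangle>"
  using qinner_cnj[of "adjoint_op H T f" u] qinner_cnj[of f "T u"] f u
    qinner_adjoint_op[OF T f u] adjoint_op_closed[OF T f] bounded_right_linear_closed[OF T u]
  by simp

lemma adjoint_op_comp_adjoint:
  assumes T: "bounded_right_linear H H T" and f: "f \<in> carrier H"
  shows "adjoint_op H (T \<circ> adjoint_op H T) f = T (adjoint_op H T f)"
proof (rule adjoint_op_eqI[OF _ f])
  note cl = bounded_right_linear_closed[OF T] adjoint_op_closed[OF T]
  show "bounded_right_linear H H (T \<circ> adjoint_op H T)"
    using bounded_right_linear_adjoint_op[OF T] T by (rule bounded_right_linear_comp)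
  show "T (adjoint_op H T f) \<in> carrier H" using f cl by simp
  show "\<langle>T (adjoint_op H T f), u\<rangle> = \<langle>f, (T \<circ> adjoint_op H T) u\<rangle>" if u: "u \<in> carrier H" for u
    using qinner_adjoint_op_right[OF T u, of "adjoint_op H T f"]
      qinner_adjoint_op[OF T f, of "adjoint_op H T u"] f u cl by simp
qed


section \<open>Orthogonal projections and images of subspaces\<close>

lemma proj_condition_iff:
  assumes W: "closed_subspace H W" and f: "f \<in> carrier H" and g: "g \<in> W"
  shows "(\<forall>w\<in>W. \<langle>w, f \<ominus> g\<rangle> = 0) \<longleftrightarrow> (\<forall>w\<in>W. \<langle>g, w\<rangle> = \<langle>f, w\<rangle>)"
proof (rule ball_cong[OF refl])
  fix w assume w: "w \<in> W"
  interpret additive_subgroup W H using W by (simp add: closed_subspace_def)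
  have c: "w \<in> carrier H" "g \<in> carrier H" using w g by auto
  have "\<langle>w, f \<ominus> g\<rangle> = 0 \<longleftrightarrow> \<langle>w, g\<rangle> = \<langle>w, f\<rangle>"
    using c f by (auto simp: qinner_diff_right)
  also have "\<dots> \<longleftrightarrow> \<langle>g, w\<rangle> = \<langle>f, w\<rangle>"
    using c f by (metis qinner_cnj)
  finally show "\<langle>w, f \<ominus> g\<rangle> = 0 \<longleftrightarrow> \<langle>g, w\<rangle> = \<langle>f, w\<rangle>" .
qed

lemma
  assumes W: "closed_subspace H W" and f: "f \<in> carrier H"
  shows proj_mem: "proj H W f \<in> W"
    and qinner_proj: "w \<in> W \<Longrightarrow> \<langle>proj H W f, w\<rangle> = \<langle>f, w\<rangle>"
proof -
  have eq: "g \<in> W \<and> (\<forall>w\<in>W. \<langle>w, f \<ominus> g\<rangle> = 0) \<longleftrightarrow> g \<in> W \<and> (\<forall>w\<in>W. \<langle>g, w\<rangle> = \<langle>f, w\<rangle>)" for g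
    using proj_condition_iff[OF W f] by (rule conj_cong[OF refl])
  have P: "proj H W f \<in> W \<and> (\<forall>w\<in>W. \<langle>proj H W f, w\<rangle> = \<langle>f, w\<rangle>)"
    unfolding proj_def eq
    by (rule theI') (rule restricted_adjoint_ex1[OF W bounded_right_linear_id f])
  show "proj H W f \<in> W" using P by (rule conjunct1)
  show "w \<in> W \<Longrightarrow> \<langle>proj H W f, w\<rangle> = \<langle>f, w\<rangle>" using P by (rule conjunct2[THEN bspec])
qed

lemma bounded_right_linear_proj:
  assumes W: "closed_subspace H W"
  shows "bounded_right_linear H H (proj H W)"
  using W bounded_right_linear_id
  by (rule restricted_adjoint_bounded_right_linear)
    (simp_all add: proj_mem[OF W] qinner_proj[OF W])

text \<open>
  Invertibility makes \<open>U\<close> bounded below, so convergence of \<open>U w\<^sub>n\<close> to \<open>U x\<close> forces convergence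
  of \<open>w\<^sub>n\<close> to \<open>x\<close>; surjectivity guarantees that every limit has the form \<open>U x\<close>.
\<close>

lemma closed_subspace_image:
  assumes W: "closed_subspace H W" and U: "bounded_right_linear H H U"
    and inv: "invertible_op H U"
  shows "closed_subspace H (U ` W)"
proof -
  have sub: "additive_subgroup W H" and Wscale: "\<And>w q. w \<in> W \<Longrightarrow> w \<cdot> q \<in> W"
    and Wclosed: "closedin metric.mtopology W"
    using W by (auto simp: closed_subspace_def)
  interpret additive_subgroup W H by (rule sub)
  have car: "u \<in> carrier H" if "u \<in> W" for u using that by auto
  have lin: "right_linear H H U" using U by (simp add: bounded_right_linear_def)
  interpret U: abelian_group_hom H H U by (rule right_linear_abelian_group_hom[OF lin])
  note Uc = bounded_right_linear_closed[OF U]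
  have bij: "bij_betw U (carrier H) (carrier H)"
    using inv by (simp add: invertible_op_def)
  obtain K where K: "0 < K"
      "\<And>u. u \<in> carrier H \<Longrightarrow> qnorm H (inv_into (carrier H) U u) \<le> K * qnorm H u"
    using inv by (auto simp: invertible_op_def bounded_op_def)
  have below: "qnorm H u \<le> K * qnorm H (U u)" if "u \<in> carrier H" for u
    using K(2)[OF Uc[OF that]] bij that by (simp add: bij_betw_def)
  have "additive_subgroup (U ` W) H"
    unfolding additive_subgroup_def
    using group_hom.subgroup_img_is_subgroup[OF U.a_group_hom] a_subgroup by simp
  moreover have "w \<cdot> q \<in> U ` W" if "w \<in> U ` W" for w q
  proof -
    obtain x where x: "x \<in> W" "w = U x" using \<open>w \<in> U ` W\<close> by blast
    then have "w \<cdot> q = U (x \<cdot> q)" using car by (simp add: right_linear_rscale[OF lin])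
    then show ?thesis using x Wscale by simp
  qed
  moreover have "closedin metric.mtopology (U ` W)"
    unfolding metric.metric_closedin_iff_sequentially_closed
  proof (intro conjI allI impI)
    show "U ` W \<subseteq> carrier H" using Uc car by auto
    fix \<sigma> y assume \<sigma>: "range \<sigma> \<subseteq> U ` W \<and> limitin metric.mtopology \<sigma> y sequentially"
    then have "\<forall>n. \<exists>w. w \<in> W \<and> \<sigma> n = U w" by blast
    then obtain s where s: "\<And>n. s n \<in> W" "\<And>n. \<sigma> n = U (s n)" by metis
    have y: "y \<in> carrier H" using \<sigma> metric.limitin_mspace by blast
    then obtain x where x: "x \<in> carrier H" "y = U x"
      using bij by (auto simp: bij_betw_def)
    have "(\<lambda>n. qdist H (\<sigma> n) y) \<longlonglongrightarrow> 0"
      using \<sigma> by (simp add: metric.limitin_metric_dist_null)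
    then have lim: "(\<lambda>n. K * qdist H (\<sigma> n) y) \<longlonglongrightarrow> 0"
      by (rule tendsto_mult_right_zero)
    have "qdist H (s n) x \<le> K * qdist H (\<sigma> n) y" for n
      using below[of "s n \<ominus> x"] s x car Uc
      by (simp add: qdist_def right_linear_diff[OF lin])
    then have "(\<lambda>n. qdist H (s n) x) \<longlonglongrightarrow> 0"
      by (intro Lim_null_comparison[OF _ lim]) simp
    then have "limitin metric.mtopology s x sequentially"
      using s x car by (simp add: metric.limitin_metric_dist_null)
    then have "x \<in> W"
      using Wclosed s metric.metric_closedin_iff_sequentially_closed by blast
    then show "y \<in> U ` W" using x by blast
  qed
  ultimately show ?thesis by (simp add: closed_subspace_def)
qed

text \<open>
  The vector \<open>f - P f\<close>, with \<open>P\<close> the projection onto \<open>U W\<close>, is orthogonal to \<open>U W\<close>; hence \<open>U\<^sup>*\<close> maps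
  it into the orthogonal complement of \<open>W\<close>, which the projection onto \<open>W\<close> annihilates.
\<close>

lemma proj_adjoint_op_proj_image:
  assumes W: "closed_subspace H W" and U: "bounded_right_linear H H U"
    and UW: "closed_subspace H (U ` W)" and f: "f \<in> carrier H"
  shows "proj H W (adjoint_op H U (proj H (U ` W) f)) = proj H W (adjoint_op H U f)"
proof -
  have sub: "additive_subgroup W H" using W by (simp add: closed_subspace_def)
  interpret additive_subgroup W H by (rule sub)
  have Pf: "proj H (U ` W) f \<in> carrier H"
    using bounded_right_linear_closed[OF bounded_right_linear_proj[OF UW] f] .
  note adj = adjoint_op_closed[OF U Pf] adjoint_op_closed[OF U f]
  show ?thesis
  proof (rule subspace_qinner_eqI[OF sub])
    fix w assume w: "w \<in> W"
    then have "w \<in> carrier H" by auto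
    then show "\<langle>proj H W (adjoint_op H U (proj H (U ` W) f)), w\<rangle>
        = \<langle>proj H W (adjoint_op H U f), w\<rangle>"
      using w adj f Pf
      by (simp add: qinner_proj[OF W] qinner_adjoint_op[OF U] qinner_proj[OF UW])
  qed (simp_all add: proj_mem[OF W] adj)
qed

end


section \<open>The transformed frame\<close>

theorem theorem4p13:
  fixes H :: "'a quat_space"
    and Hs :: "int \<Rightarrow> 'b quat_space"
    and J :: "int set"
    and U :: "'a \<Rightarrow> 'a"
    and W :: "int \<Rightarrow> 'a set"
    and \<Lambda> :: "int \<Rightarrow> 'a \<Rightarrow> 'b"
    and v :: "int \<Rightarrow> real"
    and A B :: real
  assumes "right_quat_hilbert_space H"
    and "separable_quat_space H"
    and "\<And>j. j \<in> J \<Longrightarrow> right_quat_hilbert_space (Hs j)"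
    and "bounded_right_linear H H U"
    and "invertible_op H U"
    and "g_fusion_frame H Hs J W \<Lambda> v A B"
  shows "K_g_fusion_frame H Hs J (U \<circ> adjoint_op H U)
           (\<lambda>j. U ` W j) (\<lambda>j. \<Lambda> j \<circ> proj H (W j) \<circ> adjoint_op H U) v"
proof -
  interpret right_quat_hilbert_space H by fact
  note U = \<open>bounded_right_linear H H U\<close>
  define V where "V = adjoint_op H U"
  have V: "bounded_right_linear H H V"
    unfolding V_def using U by (rule bounded_right_linear_adjoint_op)
  note Vc = bounded_right_linear_closed[OF V]
  have W: "closed_subspace H (W j)" and \<Lambda>: "bounded_right_linear H (Hs j) (\<Lambda> j)"
    and v: "0 < v j" if "j \<in> J" for j
    using assms(6) that by (auto simp: g_fusion_frame_def)
  have AB: "0 < A" "A \<le> B" using assms(6) by (auto simp: g_fusion_frame_def)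
  define F where "F f = (\<lambda>j. (v j)\<^sup>2 * (qnorm (Hs j) (\<Lambda> j (proj H (W j) f)))\<^sup>2)" for f
  have frame: "F f summable_on J" "A * (qnorm H f)\<^sup>2 \<le> infsum (F f) J"
      "infsum (F f) J \<le> B * (qnorm H f)\<^sup>2" if "f \<in> carrier H" for f
    using assms(6) that by (auto simp: g_fusion_frame_def F_def)
  have UW: "closed_subspace H (U ` W j)" if "j \<in> J" for j
    using W[OF that] U assms(5) by (rule closed_subspace_image)
  define G where "G f = (\<lambda>j. (v j)\<^sup>2 *
      (qnorm (Hs j) ((\<Lambda> j \<circ> proj H (W j) \<circ> V) (proj H (U ` W j) f)))\<^sup>2)" for f
  have G_eq: "G f j = F (V f) j" if "f \<in> carrier H" "j \<in> J" for f j
    using proj_adjoint_op_proj_image[OF W[OF that(2)] U UW[OF that(2)] that(1)]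
    by (simp add: G_def F_def V_def)
  have G_summable: "G f summable_on J \<longleftrightarrow> F (V f) summable_on J" if "f \<in> carrier H" for f
    by (rule summable_on_cong) (rule G_eq[OF that])
  have G_infsum: "infsum (G f) J = infsum (F (V f)) J" if "f \<in> carrier H" for f
    by (rule infsum_cong) (rule G_eq[OF that])
  obtain K where K: "0 < K" "\<And>u. u \<in> carrier H \<Longrightarrow> qnorm H (U u) \<le> K * qnorm H u"
    using U by (auto simp: bounded_right_linear_def bounded_op_def)
  obtain L where L: "0 < L" "\<And>u. u \<in> carrier H \<Longrightarrow> qnorm H (V u) \<le> L * qnorm H u"
    using V by (auto simp: bounded_right_linear_def bounded_op_def)
  define A' where "A' = A / K\<^sup>2"
  \<comment> \<open>The maximum only serves to keep the two bounds in the order that a frame demands.\<close>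
  define B' where "B' = max A' (B * L\<^sup>2)"
  have lower: "A' * (qnorm H (adjoint_op H (U \<circ> V) f))\<^sup>2 \<le> infsum (G f) J"
    if f: "f \<in> carrier H" for f
  proof -
    have "(qnorm H (U (V f)))\<^sup>2 \<le> (K * qnorm H (V f))\<^sup>2"
      using K(2) f Vc bounded_right_linear_closed[OF U] by (intro power_mono qnorm_nonneg) auto
    then have "A' * (qnorm H (U (V f)))\<^sup>2 \<le> A' * (K * qnorm H (V f))\<^sup>2"
      using AB by (intro mult_left_mono) (auto simp: A'_def)
    also have "\<dots> = A * (qnorm H (V f))\<^sup>2"
      using K(1) by (simp add: A'_def power_mult_distrib)
    also have "\<dots> \<le> infsum (G f) J"
      using frame(2)[OF Vc[OF f]] f by (simp add: G_infsum)
    finally show ?thesis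
      using adjoint_op_comp_adjoint[OF U f] by (simp add: V_def)
  qed
  have upper: "infsum (G f) J \<le> B' * (qnorm H f)\<^sup>2" if f: "f \<in> carrier H" for f
  proof -
    have "infsum (G f) J \<le> B * (qnorm H (V f))\<^sup>2"
      using frame(3)[OF Vc[OF f]] f by (simp add: G_infsum)
    also have "\<dots> \<le> B * (L * qnorm H f)\<^sup>2"
      using L(2) f Vc AB by (intro mult_left_mono power_mono qnorm_nonneg) auto
    also have "\<dots> \<le> B' * (qnorm H f)\<^sup>2"
      by (simp add: B'_def power_mult_distrib mult_right_mono flip: mult.assoc)
    finally show ?thesis .
  qed
  have "bounded_right_linear H (Hs j) (\<Lambda> j \<circ> proj H (W j) \<circ> V)" if "j \<in> J" for j
    using V \<Lambda>[OF that] bounded_right_linear_proj[OF W[OF that]]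
    by (intro bounded_right_linear_comp)
  moreover have "bounded_right_linear H H (U \<circ> V)"
    using V U by (rule bounded_right_linear_comp)
  moreover have "\<exists>A B. 0 < A \<and> A \<le> B \<and> (\<forall>f\<in>carrier H. G f summable_on J \<and>
      A * (qnorm H (adjoint_op H (U \<circ> V) f))\<^sup>2 \<le> infsum (G f) J \<and>
      infsum (G f) J \<le> B * (qnorm H f)\<^sup>2)"
    using lower upper frame(1) Vc AB K(1)
    by (intro exI[of _ A'] exI[of _ B']) (auto simp: G_summable A'_def B'_def)
  ultimately show ?thesis
    using UW v by (simp add: K_g_fusion_frame_def G_def V_def)
qed

end
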